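(* For each integer $n\ge 9$ there exists a $C_{-4}$-critical signed graph on $n$ vertices with either $\lceil \frac{4n}{3}\rceil$ or $\lceil\frac{4n}{3}\rceil+1$ edges.
   Context: All graphs are finite and simple. A signed graph $(G,\sigma)$ is a graph $G$ with a signature $\sigma:E(G)\to\{+,-\}$. Switching at a set $X\subseteq V(G)$ means flipping the signs of all edges with exactly one end in $X$; two signatures on $G$ are equivalent if one is obtained from the other by switching. A homomorphism $(G,\sigma)\to(H,\pi)$ exists if and only if there are a signature $\sigma'$ equivalent to $\sigma$ and a map $f:V(G)\to V(H)$ such that for every edge $uv$ of $G$, $f(u)f(v)$ is an edge of $H$ with $\pi(f(u)f(v))=\sigma'(uv)$. A subgraph of $(G,\sigma)$ is a subgraph of $G$ with the restricted signature. $C_{-4}$ is the signed 4-cycle on $u_1,u_2,u_3,u_4$ with positive edges $u_1u_2,u_2u_3,u_3u_4$ and negative edge $u_4u_1$. A signed bipartite (simple) graph is $C_{-4}$-critical if it admits no homomorphism to $C_{-4}$ but each of its proper subgraphs does. *)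

theory Defs
  imports Complex_Main
begin

datatype sign = Pos | Neg

fun flip :: "sign \<Rightarrow> sign" where
  "flip Pos = Neg"
| "flip Neg = Pos"

text \<open>
  An edge is the two-element set of its ends. The signature is a total function on sets, but only
  its values on the edges of the graph are ever used.
\<close>

record 'a signed_graph =
  verts :: "'a set"
  edges :: "'a set set"
  sgnt :: "'a set \<Rightarrow> sign"

definition wf_signed_graph :: "'a signed_graph \<Rightarrow> bool" where
  "wf_signed_graph G \<longleftrightarrow>
     finite (verts G) \<and> (\<forall>e\<in>edges G. e \<subseteq> verts G \<and> card e = 2)"

definition bipartite :: "'a signed_graph \<Rightarrow> bool" where
  "bipartite G \<longleftrightarrow>
     (\<exists>A B. A \<union> B = verts G \<and> A \<inter> B = {} \<and>
        (\<forall>e\<in>edges G. \<exists>a\<in>A. \<exists>b\<in>B. e = {a, b}))"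

definition switch :: "'a set \<Rightarrow> ('a set \<Rightarrow> sign) \<Rightarrow> 'a set \<Rightarrow> sign" where
  "switch X \<sigma> e = (if card (e \<inter> X) = 1 then flip (\<sigma> e) else \<sigma> e)"

definition switching_equiv ::
  "'a signed_graph \<Rightarrow> ('a set \<Rightarrow> sign) \<Rightarrow> ('a set \<Rightarrow> sign) \<Rightarrow> bool" where
  "switching_equiv G \<sigma> \<sigma>' \<longleftrightarrow>
     (\<exists>X\<subseteq>verts G. \<forall>e\<in>edges G. \<sigma>' e = switch X \<sigma> e)"

definition admits_hom :: "'a signed_graph \<Rightarrow> 'b signed_graph \<Rightarrow> bool" where
  "admits_hom G H \<longleftrightarrow>
     (\<exists>\<sigma>' f. switching_equiv G (sgnt G) \<sigma>' \<and> f ` verts G \<subseteq> verts H \<and>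
        (\<forall>u v. {u, v} \<in> edges G \<longrightarrow>
           {f u, f v} \<in> edges H \<and> sgnt H {f u, f v} = \<sigma>' {u, v}))"

definition subgraph :: "'a signed_graph \<Rightarrow> 'a signed_graph \<Rightarrow> bool" where
  "subgraph H G \<longleftrightarrow>
     wf_signed_graph H \<and> verts H \<subseteq> verts G \<and> edges H \<subseteq> edges G \<and>
     (\<forall>e\<in>edges H. sgnt H e = sgnt G e)"

definition proper_subgraph :: "'a signed_graph \<Rightarrow> 'a signed_graph \<Rightarrow> bool" where
  "proper_subgraph H G \<longleftrightarrow>
     subgraph H G \<and> (verts H \<noteq> verts G \<or> edges H \<noteq> edges G)"

definition C_minus4 :: "nat signed_graph" where
  "C_minus4 =
     \<lparr> verts = {1, 2, 3, 4},
       edges = {{1, 2}, {2, 3}, {3, 4}, {4, 1}},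
       sgnt = (\<lambda>e. if e = {4, 1} then Neg else Pos) \<rparr>"

definition C_minus4_critical :: "'a signed_graph \<Rightarrow> bool" where
  "C_minus4_critical G \<longleftrightarrow>
     wf_signed_graph G \<and> bipartite G \<and> \<not> admits_hom G C_minus4 \<and>
     (\<forall>H. proper_subgraph H G \<longrightarrow> admits_hom H C_minus4)"

end

theory Submission
  imports Defs
begin

text \<open>
  A homomorphism of a bipartite signed graph to $C_{-4}$ amounts to colourings $\varphi$, $\psi$ of
  the two colour classes by integers modulo 4 such that an edge $ab$ is positive if and only if
  $\varphi(a) - \psi(b) \in \{0, 1\}$: the two vertices of $C_{-4}$ on one side, each with or without
  switching, are the four colours. A negative 4-cycle with two opposite vertices $x$, $y$ and no
  further edges at the other two vertices (a digon) then says exactly that $\varphi(x) - \varphi(y)$ is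
  odd. Hence a closed chain of oddly many digons is not colourable; it has $3k$ vertices, $4k$ edges,
  and it is critical.

  To reach the other residues of $n$, some links of the chain are replaced by other gadgets which
  force the parity of the difference of two terminals in a critical way. A chain of gadgets is again
  a gadget, and lengthening it by two digons adds 6 vertices and 8 edges, so one starting chain for
  each $n \in \{9, \dots, 14\}$ suffices. The gadgets were found by computer search.
\<close>

section \<open>Colourings modulo 4 and homomorphisms to C_{-4}\<close>

definition arc_sign :: "int \<Rightarrow> int \<Rightarrow> sign" where
  "arc_sign x y = (if (x - y) mod 4 < 2 then Pos else Neg)"

text \<open>
  The first component of an arc refers to the one colour class, the second to the other; the
  numberings of the two classes are independent.
\<close>

type_synonym arc = "nat \<times> nat \<times> sign"

definition proper :: "arc set \<Rightarrow> (nat \<Rightarrow> int) \<Rightarrow> (nat \<Rightarrow> int) \<Rightarrow> bool" where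
  "proper E \<phi> \<psi> \<longleftrightarrow> (\<forall>(a, b, s)\<in>E. arc_sign (\<phi> a) (\<psi> b) = s)"

lemma properD: "proper E \<phi> \<psi> \<Longrightarrow> (a, b, s) \<in> E \<Longrightarrow> arc_sign (\<phi> a) (\<psi> b) = s"
  unfolding proper_def by (drule (1) bspec) simp

text \<open>The two colour classes become the even and the odd numbers, which keeps them disjoint.
  Every vertex is an end of an arc, so there are no isolated vertices; hence a proper subgraph
  always lacks an edge.\<close>

definition arc_graph :: "arc set \<Rightarrow> nat signed_graph" where
  "arc_graph E =
     \<lparr> verts = (\<lambda>(a, b, s). 2 * a) ` E \<union> (\<lambda>(a, b, s). 2 * b + 1) ` E,
       edges = (\<lambda>(a, b, s). {2 * a, 2 * b + 1}) ` E,
       sgnt = (\<lambda>e. if \<exists>a b. e = {2 * a, 2 * b + 1} \<and> (a, b, Neg) \<in> E then Neg else Pos) \<rparr>"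

lemma even_odd_pair_eq_iff:
  "{2 * a, Suc (2 * b)} = {2 * a', Suc (2 * b')} \<longleftrightarrow> a = a' \<and> b = b'"
  unfolding doubleton_eq_iff by presburger

lemma flip_flip [simp]: "flip (flip s) = s"
  by (cases s) auto

lemma edge_C_minus4_iff:
  "{i, j} \<in> edges C_minus4 \<longleftrightarrow>
     (i, j) \<in> {(1, 2), (2, 1), (2, 3), (3, 2), (3, 4), (4, 3), (4, 1), (1, 4)}"
  by (auto simp: C_minus4_def doubleton_eq_iff)

lemma sgnt_C_minus4:
  "sgnt C_minus4 {i, j} = (if (i, j) \<in> {(4, 1), (1, 4)} then Neg else Pos)"
  by (auto simp: C_minus4_def doubleton_eq_iff)

lemma card_pair_Int_eq_1_iff:
  assumes "u \<noteq> v"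
  shows "card ({u, v} \<inter> X) = 1 \<longleftrightarrow> (u \<in> X) \<noteq> (v \<in> X)"
  using assms by (cases "u \<in> X"; cases "v \<in> X") auto

text \<open>Adding 2 to one argument of \<open>arc_sign\<close> negates it, so a switching set can
  be absorbed into the colours: a colour modulo 4 is an image vertex together with a bit for
  membership in the switching set. The graph is arbitrary up to the even-odd form of its edges
  because the lemma is also applied to subgraphs of an \<open>arc_graph\<close>.\<close>

lemma admits_hom_iff_coloring:
  fixes H :: "nat signed_graph"
  assumes inV: "\<forall>e\<in>edges H. e \<subseteq> verts H"
    and bip: "\<forall>e\<in>edges H. \<exists>a b. e = {2 * a, 2 * b + 1}"
  shows "admits_hom H C_minus4 \<longleftrightarrow>
    (\<exists>\<phi> \<psi>. \<forall>a b. {2 * a, 2 * b + 1} \<in> edges H \<longrightarrow>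
       arc_sign (\<phi> a) (\<psi> b) = sgnt H {2 * a, 2 * b + 1})" (is "_ \<longleftrightarrow> ?C")
proof
  assume "admits_hom H C_minus4"
  then obtain \<sigma>' f where se: "switching_equiv H (sgnt H) \<sigma>'" and
    hom: "\<forall>u v. {u, v} \<in> edges H \<longrightarrow>
      {f u, f v} \<in> edges C_minus4 \<and> sgnt C_minus4 {f u, f v} = \<sigma>' {u, v}"
    unfolding admits_hom_def by (elim exE conjE) (rule that)
  from se obtain X where sw: "\<forall>e\<in>edges H. \<sigma>' e = switch X (sgnt H) e"
    unfolding switching_equiv_def by blast
  define h where "h v = (if v \<in> X then 2 else 0 :: int)" for v
  \<comment> \<open>A homomorphism may send an even vertex to either side of
    \<open>C_minus4\<close>. The different roundings in \<open>\<phi>\<close> and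
    \<open>\<psi>\<close> make one formula serve both: the pairs of images (1 or 3, 2 or 4) and (2
    or 4, 1 or 3) both give the right signs.\<close>
  define \<phi> where "\<phi> a = int (f (2 * a)) div 2 + h (2 * a)" for a
  define \<psi> where "\<psi> b = (int (f (2 * b + 1)) - 1) div 2 + h (2 * b + 1)" for b
  have "arc_sign (\<phi> a) (\<psi> b) = sgnt H {2 * a, 2 * b + 1}" if e: "{2 * a, 2 * b + 1} \<in> edges H" for a b
  proof -
    have ne: "2 * a \<noteq> 2 * b + 1" by presburger
    note home = hom[rule_format, OF e]
    have s: "sgnt C_minus4 {f (2 * a), f (2 * b + 1)} =
        (if (2 * a \<in> X) \<noteq> (2 * b + 1 \<in> X) then flip (sgnt H {2 * a, 2 * b + 1})
         else sgnt H {2 * a, 2 * b + 1})"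
      using home sw[rule_format, OF e] card_pair_Int_eq_1_iff[OF ne, of X] by (simp add: switch_def)
    \<comment> \<open>Since \<open>flip\<close> is an involution, the equation can be solved for the
      sign in \<open>H\<close>; what remains is a check over the eight ordered adjacent pairs of
      \<open>C_minus4\<close>.\<close>
    have "sgnt H {2 * a, 2 * b + 1} =
        (if (2 * a \<in> X) \<noteq> (2 * b + 1 \<in> X) then flip (sgnt C_minus4 {f (2 * a), f (2 * b + 1)})
         else sgnt C_minus4 {f (2 * a), f (2 * b + 1)})"
      unfolding s by simp
    then show ?thesis
      using home unfolding edge_C_minus4_iff sgnt_C_minus4
      by (auto simp: \<phi>_def \<psi>_def h_def arc_sign_def)
  qed
  then show ?C by (intro exI[of _ \<phi>] exI[of _ \<psi>]) simp
next
  assume ?C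
  then obtain \<phi> \<psi> where
    col: "\<forall>a b. {2 * a, 2 * b + 1} \<in> edges H \<longrightarrow>
      arc_sign (\<phi> a) (\<psi> b) = sgnt H {2 * a, 2 * b + 1}"
    by (elim exE)
  define c where "c v = (if even v then \<phi> (v div 2) else \<psi> (v div 2)) mod 4" for v
  define X where "X = {v \<in> verts H. c v \<ge> 2}"
  \<comment> \<open>The parity of the colour selects the image vertex, 1 or 3 for the even class and
    2 or 4 for the odd class; colours 2 and 3 are the switched copies of 0 and 1.\<close>
  define f :: "nat \<Rightarrow> nat" where
    "f v = (if even v then (if even (c v) then 1 else 3) else (if even (c v) then 2 else 4))" for v
  have key: "{f u, f v} \<in> edges C_minus4 \<and> sgnt C_minus4 {f u, f v} = switch X (sgnt H) {u, v}"
    if e: "{u, v} \<in> edges H" and u: "u = 2 * a" and v: "v = 2 * b + 1" for u v a b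
  proof -
    have X: "u \<in> X \<longleftrightarrow> c u \<ge> 2" "v \<in> X \<longleftrightarrow> c v \<ge> 2" using inV e by (auto simp: X_def)
    have ne: "u \<noteq> v" using u v by presburger
    have par: "even u" "odd v" using u v by auto
    have "arc_sign (c u) (c v) = sgnt H {u, v}"
      using col[rule_format, of a b] e u v by (simp add: c_def arc_sign_def mod_diff_eq)
    moreover have "x mod 4 \<in> {0, 1, 2, 3}" for x :: int by auto
    then have "c u \<in> {0, 1, 2, 3}" "c v \<in> {0, 1, 2, 3}" unfolding c_def by blast+
    ultimately show ?thesis
      unfolding edge_C_minus4_iff sgnt_C_minus4 switch_def card_pair_Int_eq_1_iff[OF ne] X f_def
      using par by (auto simp: arc_sign_def)
  qed
  have "{f u, f v} \<in> edges C_minus4 \<and> sgnt C_minus4 {f u, f v} = switch X (sgnt H) {u, v}"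
    if e: "{u, v} \<in> edges H" for u v
  proof -
    obtain a b where "{u, v} = {2 * a, 2 * b + 1}" using bip e by blast
    then consider "u = 2 * a" "v = 2 * b + 1" | "v = 2 * a" "u = 2 * b + 1"
      by (auto simp: doubleton_eq_iff)
    then show ?thesis
      using key[of u v a b] key[of v u a b] e by cases (auto simp: insert_commute)
  qed
  moreover have "f ` verts H \<subseteq> verts C_minus4" by (auto simp: f_def C_minus4_def)
  moreover have "switching_equiv H (sgnt H) (switch X (sgnt H))"
    unfolding switching_equiv_def by (rule exI[of _ X]) (auto simp: X_def)
  ultimately show "admits_hom H C_minus4"
    unfolding admits_hom_def by (intro exI[of _ f] exI[of _ "switch X (sgnt H)"]) simp
qed

section \<open>Criticality of arc graphs\<close>

text \<open>Injectivity on the pairs of ends excludes parallel arcs of opposite signs, so the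
  signature of the graph is read off unambiguously.\<close>

lemma sgnt_arc_graph:
  assumes "inj_on (\<lambda>(a, b, s). (a, b)) E" "(a, b, s) \<in> E"
  shows "sgnt (arc_graph E) {2 * a, 2 * b + 1} = s"
proof -
  have "(a, b, Neg) \<in> E \<longleftrightarrow> s = Neg"
    using inj_onD[OF assms(1), of "(a, b, s)" "(a, b, Neg)"] assms(2) by auto
  then show ?thesis
    unfolding arc_graph_def by (cases s) (auto simp: even_odd_pair_eq_iff)
qed

lemma edge_arc_graph_iff:
  "{2 * a, 2 * b + 1} \<in> edges (arc_graph E) \<longleftrightarrow> (\<exists>s. (a, b, s) \<in> E)"
  by (auto simp: arc_graph_def even_odd_pair_eq_iff image_iff Bex_def)

text \<open>Single-arc deletions suffice: a proper subgraph misses some edge, and a colouring found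
  after deleting the corresponding arc restricts to the subgraph.\<close>

lemma critical_arc_graph:
  assumes fin: "finite E" and inj: "inj_on (\<lambda>(a, b, s). (a, b)) E"
    and non: "\<And>\<phi> \<psi>. \<not> proper E \<phi> \<psi>"
    and crit: "\<And>t. t \<in> E \<Longrightarrow> \<exists>\<phi> \<psi>. proper (E - {t}) \<phi> \<psi>"
  shows "C_minus4_critical (arc_graph E)"
proof -
  let ?G = "arc_graph E"
  have Evert: "\<forall>e\<in>edges ?G. e \<subseteq> verts ?G"
    by (force simp: arc_graph_def)
  have Ebip: "\<forall>e\<in>edges ?G. \<exists>a b. e = {2 * a, 2 * b + 1}"
    by (auto simp: arc_graph_def)
  have wf: "wf_signed_graph ?G"
    unfolding wf_signed_graph_def
  proof (intro conjI ballI)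
    show "finite (verts ?G)" using fin by (simp add: arc_graph_def)
    fix e assume e: "e \<in> edges ?G"
    show "e \<subseteq> verts ?G" using Evert e by blast
    obtain a b where "e = {2 * a, 2 * b + 1}" using Ebip e by blast
    moreover have "2 * a \<noteq> 2 * b + 1" by presburger
    ultimately show "card e = 2" by simp
  qed
  have bip: "bipartite ?G"
    unfolding bipartite_def
  proof (intro exI conjI ballI)
    show "(\<lambda>(a, b, s). 2 * a) ` E \<union> (\<lambda>(a, b, s). 2 * b + 1) ` E = verts ?G"
      by (simp add: arc_graph_def)
    show "(\<lambda>(a, b, s). 2 * a) ` E \<inter> (\<lambda>(a, b, s). 2 * b + 1) ` E = {}"
    proof -
      have "2 * a \<noteq> Suc (2 * b)" for a b :: nat by presburger
      then show ?thesis by auto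
    qed
    fix e assume "e \<in> edges ?G"
    then obtain a b s where abs: "(a, b, s) \<in> E" "e = {2 * a, 2 * b + 1}"
      by (auto simp: arc_graph_def)
    have "2 * a \<in> (\<lambda>(a, b, s). 2 * a) ` E" "2 * b + 1 \<in> (\<lambda>(a, b, s). 2 * b + 1) ` E"
      using abs(1) by (auto intro!: image_eqI[of _ _ "(a, b, s)"])
    then show "\<exists>a\<in>(\<lambda>(a, b, s). 2 * a) ` E. \<exists>b\<in>(\<lambda>(a, b, s). 2 * b + 1) ` E. e = {a, b}"
      unfolding abs(2) by blast
  qed
  have "\<not> admits_hom ?G C_minus4"
  proof
    assume hom: "admits_hom ?G C_minus4"
    obtain \<phi> \<psi> where
      col: "\<forall>a b. {2 * a, 2 * b + 1} \<in> edges ?G \<longrightarrow>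
        arc_sign (\<phi> a) (\<psi> b) = sgnt ?G {2 * a, 2 * b + 1}"
      using iffD1[OF admits_hom_iff_coloring[OF Evert Ebip] hom] by (elim exE)
    have "arc_sign (\<phi> a) (\<psi> b) = s" if "(a, b, s) \<in> E" for a b s
    proof -
      have "{2 * a, 2 * b + 1} \<in> edges ?G" using that edge_arc_graph_iff by blast
      then show ?thesis using col sgnt_arc_graph[OF inj that] by simp
    qed
    then have "proper E \<phi> \<psi>" by (auto simp: proper_def)
    with non show False by blast
  qed
  moreover have "admits_hom H C_minus4" if H: "proper_subgraph H ?G" for H
  proof -
    have wfH: "wf_signed_graph H" and sub: "edges H \<subseteq> edges ?G" "verts H \<subseteq> verts ?G"
      and sg: "\<And>e. e \<in> edges H \<Longrightarrow> sgnt H e = sgnt ?G e"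
      using H unfolding proper_subgraph_def subgraph_def by auto
    have HV: "\<forall>e\<in>edges H. e \<subseteq> verts H"
      using wfH by (auto simp: wf_signed_graph_def)
    \<comment> \<open>If all edges were present, so would be all their ends, and these are all the
      vertices.\<close>
    have "edges H \<noteq> edges ?G"
    proof
      assume eq: "edges H = edges ?G"
      have "verts ?G \<subseteq> \<Union> (edges ?G)" by (force simp: arc_graph_def)
      with HV eq sub have "verts H = verts ?G" by blast
      with eq H show False by (simp add: proper_subgraph_def)
    qed
    then obtain a0 b0 s0 where t: "(a0, b0, s0) \<in> E" "{2 * a0, 2 * b0 + 1} \<notin> edges H"
      using sub by (auto simp: arc_graph_def)
    obtain \<phi> \<psi> where p: "proper (E - {(a0, b0, s0)}) \<phi> \<psi>" using crit[OF t(1)] by blast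
    have "arc_sign (\<phi> a) (\<psi> b) = sgnt H {2 * a, 2 * b + 1}" if e: "{2 * a, 2 * b + 1} \<in> edges H" for a b
    proof -
      obtain s where s: "(a, b, s) \<in> E" using e sub edge_arc_graph_iff by blast
      have "(a, b) \<noteq> (a0, b0)" using e t(2) by auto
      then have "(a, b, s) \<in> E - {(a0, b0, s0)}" using s by auto
      then have "arc_sign (\<phi> a) (\<psi> b) = s" using p properD by blast
      then show ?thesis using sgnt_arc_graph[OF inj s] sg[OF e] by simp
    qed
    then have "\<exists>\<phi> \<psi>. \<forall>a b. {2 * a, 2 * b + 1} \<in> edges H \<longrightarrow>
        arc_sign (\<phi> a) (\<psi> b) = sgnt H {2 * a, 2 * b + 1}"
      by (intro exI[of _ \<phi>] exI[of _ \<psi>]) simp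
    moreover have "\<forall>e\<in>edges H. \<exists>a b. e = {2 * a, 2 * b + 1}"
      using Ebip sub(1) by blast
    ultimately show ?thesis
      using admits_hom_iff_coloring[OF HV] by simp
  qed
  ultimately show ?thesis using wf bip by (simp add: C_minus4_critical_def)
qed

section \<open>Gadgets and their series composition\<close>

text \<open>
  The terminals are the first and the last vertex, 0 and \<open>m\<close>, of the first colour class; deleting any
  arc must make the other parity of their difference possible. If \<open>flexible\<close> holds as well, both
  residues modulo 4 of the forced parity occur. This is what makes the arcs of a closing digon
  critical: a digon without one arc excludes only one of the two even residues.
\<close>

definition gadget :: "arc set \<Rightarrow> nat \<Rightarrow> nat \<Rightarrow> int \<Rightarrow> bool" where
  "gadget E m l r \<longleftrightarrow>
     fst ` E = {..m} \<and> (fst \<circ> snd) ` E = {..<l} \<and> inj_on (\<lambda>(a, b, s). (a, b)) E \<and>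
     (\<forall>\<phi> \<psi>. proper E \<phi> \<psi> \<longrightarrow> even (\<phi> m - \<phi> 0 - r)) \<and>
     (\<forall>t\<in>E. \<exists>\<phi> \<psi>. proper (E - {t}) \<phi> \<psi> \<and> odd (\<phi> m - \<phi> 0 - r)) \<and>
     (\<exists>\<phi> \<psi>. proper E \<phi> \<psi>)"

definition flexible :: "arc set \<Rightarrow> nat \<Rightarrow> int \<Rightarrow> bool" where
  "flexible E m r \<longleftrightarrow>
     (\<forall>d. even (d - r) \<longrightarrow> (\<exists>\<phi> \<psi>. proper E \<phi> \<psi> \<and> (\<phi> m - \<phi> 0) mod 4 = d mod 4))"

text \<open>With \<open>m\<close> and \<open>l\<close> the parameters of a preceding gadget,
  terminal 0 of the copy falls on terminal \<open>m\<close> of that gadget, while the second colour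
  classes stay disjoint.\<close>

definition shift_arcs :: "nat \<Rightarrow> nat \<Rightarrow> arc set \<Rightarrow> arc set" where
  "shift_arcs m l E = (\<lambda>(a, b, s). (m + a, l + b, s)) ` E"

lemma proper_mono: "proper E \<phi> \<psi> \<Longrightarrow> E' \<subseteq> E \<Longrightarrow> proper E' \<phi> \<psi>"
  unfolding proper_def by (rule ballI) (drule (1) subsetD, erule (1) bspec)

lemma proper_Un: "proper (E \<union> E') \<phi> \<psi> \<longleftrightarrow> proper E \<phi> \<psi> \<and> proper E' \<phi> \<psi>"
  by (simp add: proper_def ball_Un)

lemma proper_shift_arcs:
  "proper (shift_arcs m l E) \<phi> \<psi> \<longleftrightarrow> proper E (\<lambda>a. \<phi> (m + a)) (\<lambda>b. \<psi> (l + b))"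
  by (auto simp: proper_def shift_arcs_def)

text \<open>\<open>arc_sign\<close> depends only on the difference of its arguments. In particular,
  all colours may be translated by a common constant.\<close>

lemma proper_cong:
  assumes "\<And>a b s. (a, b, s) \<in> E \<Longrightarrow> \<phi> a - \<psi> b = \<phi>' a - \<psi>' b"
  shows "proper E \<phi> \<psi> \<longleftrightarrow> proper E \<phi>' \<psi>'"
proof -
  have "arc_sign (\<phi> a) (\<psi> b) = arc_sign (\<phi>' a) (\<psi>' b)" if "(a, b, s) \<in> E" for a b s
    using assms[OF that] by (simp add: arc_sign_def)
  then show ?thesis unfolding proper_def by fastforce
qed

text \<open>Translating the second colouring by \<open>c\<close> makes the two agree at the shared
  terminal \<open>m1\<close>; the terminal differences then add up.\<close>

lemma proper_glue:
  assumes "proper E1 \<phi>1 \<psi>1" "proper E2 \<phi>2 \<psi>2"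
    and sub: "E1 \<subseteq> {..m1} \<times> {..<l1} \<times> UNIV"
  obtains \<phi> \<psi> where "proper (E1 \<union> shift_arcs m1 l1 E2) \<phi> \<psi>"
    "\<phi> (m1 + m2) - \<phi> 0 = (\<phi>1 m1 - \<phi>1 0) + (\<phi>2 m2 - \<phi>2 0)"
proof -
  have bd: "\<And>a b s. (a, b, s) \<in> E1 \<Longrightarrow> a \<le> m1 \<and> b < l1" using sub by blast
  define c where "c = \<phi>1 m1 - \<phi>2 0"
  define \<phi> where "\<phi> a = (if a \<le> m1 then \<phi>1 a else \<phi>2 (a - m1) + c)" for a
  define \<psi> where "\<psi> b = (if b < l1 then \<psi>1 b else \<psi>2 (b - l1) + c)" for b
  \<comment> \<open>The case \<open>a = 0\<close> is the shared terminal, where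
    \<open>\<phi>\<close> is defined through \<open>\<phi>1\<close>; the choice of \<open>c\<close>
    makes both descriptions equal.\<close>
  have \<phi>2: "\<phi> (m1 + a) = \<phi>2 a + c" for a by (cases "a = 0") (auto simp: \<phi>_def c_def)
  have "proper E1 \<phi> \<psi>"
    using assms(1) by (subst proper_cong[of _ _ _ \<phi>1 \<psi>1]) (auto simp: \<phi>_def \<psi>_def dest: bd)
  moreover have "proper (shift_arcs m1 l1 E2) \<phi> \<psi>"
    unfolding proper_shift_arcs
    using assms(2) by (subst proper_cong[of _ _ _ \<phi>2 \<psi>2]) (auto simp: \<phi>2 \<psi>_def)
  moreover have "\<phi> (m1 + m2) - \<phi> 0 = (\<phi>1 m1 - \<phi>1 0) + (\<phi>2 m2 - \<phi>2 0)"
    unfolding \<phi>2 by (simp add: c_def \<phi>_def)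
  ultimately show thesis by (intro that[of \<phi> \<psi>]) (simp_all add: proper_Un)
qed

lemma gadget_parity:
  assumes "gadget E m l r" "proper E \<phi> \<psi>"
  shows "even (\<phi> m - \<phi> 0 - r)"
proof -
  have "\<forall>\<phi> \<psi>. proper E \<phi> \<psi> \<longrightarrow> even (\<phi> m - \<phi> 0 - r)"
    using assms(1) unfolding gadget_def by (elim conjE)
  then show ?thesis using assms(2) by (elim allE impE)
qed

lemma gadget_delete:
  assumes "gadget E m l r" "t \<in> E"
  obtains \<phi> \<psi> where "proper (E - {t}) \<phi> \<psi>" "odd (\<phi> m - \<phi> 0 - r)"
proof -
  have "\<forall>t\<in>E. \<exists>\<phi> \<psi>. proper (E - {t}) \<phi> \<psi> \<and> odd (\<phi> m - \<phi> 0 - r)"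
    using assms(1) unfolding gadget_def by (elim conjE)
  from bspec[OF this assms(2)] show thesis by (elim exE conjE) (rule that)
qed

lemma gadget_colorable:
  assumes "gadget E m l r"
  obtains \<phi> \<psi> where "proper E \<phi> \<psi>"
proof -
  have "\<exists>\<phi> \<psi>. proper E \<phi> \<psi>" using assms unfolding gadget_def by (elim conjE)
  then show thesis by (elim exE) (rule that)
qed

lemma flexible_coloring:
  assumes "flexible E m r" "even (d - r)"
  obtains \<phi> \<psi> where "proper E \<phi> \<psi>" "(\<phi> m - \<phi> 0) mod 4 = d mod 4"
proof -
  have "\<exists>\<phi> \<psi>. proper E \<phi> \<psi> \<and> (\<phi> m - \<phi> 0) mod 4 = d mod 4"
    using assms unfolding flexible_def by (elim allE impE)
  then show thesis by (elim exE conjE) (rule that)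
qed

lemma gadget_images:
  assumes "gadget E m l r"
  shows "fst ` E = {..m}" and "(fst \<circ> snd) ` E = {..<l}"
  using assms by (simp_all only: gadget_def)

lemma gadget_inj_on:
  assumes "gadget E m l r"
  shows "inj_on (\<lambda>(a, b, s). (a, b)) E"
  using assms unfolding gadget_def by (elim conjE)

lemma gadget_subset:
  assumes "gadget E m l r"
  shows "E \<subseteq> {..m} \<times> {..<l} \<times> UNIV"
proof
  fix t assume t: "t \<in> E"
  have "fst t \<in> {..m}" "(fst \<circ> snd) t \<in> {..<l}"
    unfolding gadget_images[OF assms, symmetric] by (rule imageI[OF t])+
  then show "t \<in> {..m} \<times> {..<l} \<times> UNIV" by (simp add: mem_Times_iff)
qed

lemma gadget_finite:
  assumes "gadget E m l r"
  shows "finite E"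
proof (rule finite_imageD[OF _ gadget_inj_on[OF assms]])
  have "(\<lambda>(a, b, s). (a, b)) ` E \<subseteq> {..m} \<times> {..<l}"
    using gadget_subset[OF assms] by auto
  then show "finite ((\<lambda>(a, b, s). (a, b)) ` E)" by (rule finite_subset) simp
qed

text \<open>The ranges overlap in \<open>m1\<close>, the shared terminal; this is why the first
  class is measured by closed and the second by half-open intervals.\<close>

lemma atMost_Un_shift: "{..m1} \<union> (+) m1 ` {..m2} = {..m1 + m2 :: nat}"
proof -
  have "x \<in> (+) m1 ` {..m2}" if "x \<le> m1 + m2" "\<not> x \<le> m1" for x
    using that by (intro image_eqI[of _ _ "x - m1"]) auto
  then show ?thesis by auto
qed

lemma lessThan_Un_shift: "{..<l1} \<union> (+) l1 ` {..<l2} = {..<l1 + l2 :: nat}"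
proof -
  have "x \<in> (+) l1 ` {..<l2}" if "x < l1 + l2" "\<not> x < l1" for x
    using that by (intro image_eqI[of _ _ "x - l1"]) auto
  then show ?thesis by auto
qed

text \<open>The second ends separate the two parts: they are below \<open>l\<close> in
  \<open>E1\<close> and at least \<open>l\<close> in the shifted copy.\<close>

lemma inj_on_ends_Un_shift:
  assumes "inj_on (\<lambda>(a, b, s). (a, b)) E1" "inj_on (\<lambda>(a, b, s). (a, b)) E2"
    and "\<And>a b s. (a, b, s) \<in> E1 \<Longrightarrow> b < l"
  shows "inj_on (\<lambda>(a, b, s). (a, b)) (E1 \<union> shift_arcs m l E2)"
  unfolding inj_on_Un
proof (intro conjI)
  have "inj_on ((\<lambda>(a, b). (m + a, l + b)) \<circ> (\<lambda>(a, b, s). (a, b))) E2"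
    using assms(2) by (rule comp_inj_on) (auto simp: inj_on_def)
  then have "inj_on ((\<lambda>(a, b, s). (a, b)) \<circ> (\<lambda>(a, b, s). (m + a, l + b, s))) E2"
    by (simp add: comp_def split_def)
  then show "inj_on (\<lambda>(a, b, s). (a, b)) (shift_arcs m l E2)"
    unfolding shift_arcs_def by (rule inj_on_imageI)
  show "(\<lambda>(a, b, s). (a, b)) ` (E1 - shift_arcs m l E2) \<inter>
      (\<lambda>(a, b, s). (a, b)) ` (shift_arcs m l E2 - E1) = {}"
    using assms(3) by (auto simp: shift_arcs_def)
qed (rule assms(1))

lemma card_Un_shift:
  assumes "finite E1" "finite E2" and "\<And>a b s. (a, b, s) \<in> E1 \<Longrightarrow> b < l"
  shows "card (E1 \<union> shift_arcs m l E2) = card E1 + card E2"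
proof -
  have "inj_on (\<lambda>(a, b, s). (m + a, l + b, s)) E2" by (auto simp: inj_on_def)
  then have "card (shift_arcs m l E2) = card E2" by (simp add: shift_arcs_def card_image)
  moreover have "E1 \<inter> shift_arcs m l E2 = {}"
    using assms(3) by (auto simp: shift_arcs_def)
  moreover have "finite (shift_arcs m l E2)" using assms(2) by (simp add: shift_arcs_def)
  ultimately show ?thesis using assms(1) by (simp add: card_Un_disjoint)
qed

text \<open>The forced parities add. After deleting an arc, its own part gets a colouring of the
  wrong parity and the other part any proper colouring, whose parity is still forced, so the total
  parity is wrong.\<close>

lemma gadget_series:
  assumes g1: "gadget E1 m1 l1 r1" and g2: "gadget E2 m2 l2 r2"
  shows "gadget (E1 \<union> shift_arcs m1 l1 E2) (m1 + m2) (l1 + l2) (r1 + r2)"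
    (is "gadget ?E _ _ _")
  unfolding gadget_def
proof (intro conjI allI impI ballI)
  note sub = gadget_subset[OF g1]
  have sh: "fst ` shift_arcs m1 l1 E2 = (+) m1 ` fst ` E2"
    "(fst \<circ> snd) ` shift_arcs m1 l1 E2 = (+) l1 ` (fst \<circ> snd) ` E2"
    by (force simp: shift_arcs_def)+
  show "fst ` ?E = {..m1 + m2}"
    unfolding image_Un sh gadget_images[OF g1] gadget_images[OF g2] by (rule atMost_Un_shift)
  show "(fst \<circ> snd) ` ?E = {..<l1 + l2}"
    unfolding image_Un sh gadget_images[OF g1] gadget_images[OF g2] by (rule lessThan_Un_shift)
  show "inj_on (\<lambda>(a, b, s). (a, b)) ?E"
    using sub by (intro inj_on_ends_Un_shift gadget_inj_on[OF g1] gadget_inj_on[OF g2]) auto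
  show "even (\<phi> (m1 + m2) - \<phi> 0 - (r1 + r2))" if "proper ?E \<phi> \<psi>" for \<phi> \<psi>
  proof -
    have "proper E1 \<phi> \<psi>" "proper E2 (\<lambda>a. \<phi> (m1 + a)) (\<lambda>b. \<psi> (l1 + b))"
      using that unfolding proper_Un proper_shift_arcs by auto
    from gadget_parity[OF g1 this(1)] gadget_parity[OF g2 this(2)] show ?thesis by auto
  qed
  obtain \<phi>1 \<psi>1 where c1: "proper E1 \<phi>1 \<psi>1" using gadget_colorable[OF g1] .
  obtain \<phi>2 \<psi>2 where c2: "proper E2 \<phi>2 \<psi>2" using gadget_colorable[OF g2] .
  note p1 = gadget_parity[OF g1 c1] and p2 = gadget_parity[OF g2 c2]
  obtain \<phi> \<psi> where "proper ?E \<phi> \<psi>" using proper_glue[OF c1 c2 sub] by metis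
  then show "\<exists>\<phi> \<psi>. proper ?E \<phi> \<psi>" by (intro exI)
  show "\<exists>\<phi> \<psi>. proper (?E - {t}) \<phi> \<psi> \<and> odd (\<phi> (m1 + m2) - \<phi> 0 - (r1 + r2))"
    if "t \<in> ?E" for t
    using that
  proof
    assume "t \<in> E1"
    then obtain \<phi>' \<psi>' where c': "proper (E1 - {t}) \<phi>' \<psi>'" "odd (\<phi>' m1 - \<phi>' 0 - r1)"
      using gadget_delete[OF g1] by metis
    have sub': "E1 - {t} \<subseteq> {..m1} \<times> {..<l1} \<times> UNIV" using sub by blast
    obtain \<phi> \<psi> where c: "proper ((E1 - {t}) \<union> shift_arcs m1 l1 E2) \<phi> \<psi>"
      "\<phi> (m1 + m2) - \<phi> 0 = (\<phi>' m1 - \<phi>' 0) + (\<phi>2 m2 - \<phi>2 0)"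
      using proper_glue[OF c'(1) c2 sub'] by metis
    have "?E - {t} \<subseteq> (E1 - {t}) \<union> shift_arcs m1 l1 E2" by blast
    then have "proper (?E - {t}) \<phi> \<psi>" using proper_mono c(1) by simp
    moreover have "odd (\<phi> (m1 + m2) - \<phi> 0 - (r1 + r2))" unfolding c(2) using c'(2) p2 by auto
    ultimately show ?thesis by (intro exI conjI)
  next
    assume "t \<in> shift_arcs m1 l1 E2"
    then obtain t2 where t2: "t2 \<in> E2" "t = (case t2 of (a, b, s) \<Rightarrow> (m1 + a, l1 + b, s))"
      by (auto simp: shift_arcs_def)
    obtain \<phi>' \<psi>' where c': "proper (E2 - {t2}) \<phi>' \<psi>'" "odd (\<phi>' m2 - \<phi>' 0 - r2)"
      using gadget_delete[OF g2 t2(1)] .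
    obtain \<phi> \<psi> where c: "proper (E1 \<union> shift_arcs m1 l1 (E2 - {t2})) \<phi> \<psi>"
      "\<phi> (m1 + m2) - \<phi> 0 = (\<phi>1 m1 - \<phi>1 0) + (\<phi>' m2 - \<phi>' 0)"
      using proper_glue[OF c1 c'(1) sub] by metis
    have "?E - {t} \<subseteq> E1 \<union> shift_arcs m1 l1 (E2 - {t2})"
      unfolding shift_arcs_def using t2(2) by blast
    then have "proper (?E - {t}) \<phi> \<psi>" using proper_mono c(1) by simp
    moreover have "odd (\<phi> (m1 + m2) - \<phi> 0 - (r1 + r2))" unfolding c(2) using c'(2) p1 by auto
    ultimately show ?thesis by (intro exI conjI)
  qed
qed

text \<open>It is enough that the first part is flexible: for any fixed colouring of the second
  part, the first supplies the missing residue modulo 4.\<close>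

lemma flexible_series:
  assumes g1: "gadget E1 m1 l1 r1" and f1: "flexible E1 m1 r1" and g2: "gadget E2 m2 l2 r2"
  shows "flexible (E1 \<union> shift_arcs m1 l1 E2) (m1 + m2) (r1 + r2)"
  unfolding flexible_def
proof (intro allI impI)
  fix d :: int assume d: "even (d - (r1 + r2))"
  obtain \<phi>2 \<psi>2 where c2: "proper E2 \<phi>2 \<psi>2" using gadget_colorable[OF g2] .
  note p2 = gadget_parity[OF g2 c2]
  let ?d = "\<phi>2 m2 - \<phi>2 0"
  have "even (d - ?d - r1)" using d p2 by auto
  then obtain \<phi>1 \<psi>1 where c1: "proper E1 \<phi>1 \<psi>1" and d1: "(\<phi>1 m1 - \<phi>1 0) mod 4 = (d - ?d) mod 4"
    using flexible_coloring[OF f1] by metis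
  obtain \<phi> \<psi> where c: "proper (E1 \<union> shift_arcs m1 l1 E2) \<phi> \<psi>"
    "\<phi> (m1 + m2) - \<phi> 0 = (\<phi>1 m1 - \<phi>1 0) + ?d"
    using proper_glue[OF c1 c2 gadget_subset[OF g1]] by metis
  have "(\<phi> (m1 + m2) - \<phi> 0) mod 4 = d mod 4"
    unfolding c(2) using mod_add_cong[OF d1 refl, of ?d] by simp
  with c(1) show "\<exists>\<phi> \<psi>. proper (E1 \<union> shift_arcs m1 l1 E2) \<phi> \<psi> \<and>
      (\<phi> (m1 + m2) - \<phi> 0) mod 4 = d mod 4"
    by (intro exI conjI)
qed

section \<open>Counting, and closing a gadget by a digon\<close>

lemma card_edges_arc_graph:
  assumes "inj_on (\<lambda>(a, b, s). (a, b)) E"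
  shows "card (edges (arc_graph E)) = card E"
proof -
  have "inj_on (\<lambda>(a, b, s). {2 * a, 2 * b + 1}) E"
  proof (intro inj_onI)
    fix x y assume xy: "x \<in> E" "y \<in> E"
      "(case x of (a, b, s) \<Rightarrow> {2 * a, 2 * b + 1}) = (case y of (a, b, s) \<Rightarrow> {2 * a, 2 * b + 1})"
    then have "(\<lambda>(a, b, s). (a, b)) x = (\<lambda>(a, b, s). (a, b)) y"
      by (auto simp: even_odd_pair_eq_iff split: prod.splits)
    with assms xy show "x = y" by (auto dest: inj_onD)
  qed
  then show ?thesis by (simp add: arc_graph_def card_image)
qed

lemma card_verts_arc_graph:
  assumes "fst ` E = {..m}" "(fst \<circ> snd) ` E = {..<l}"
  shows "card (verts (arc_graph E)) = Suc m + l"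
proof -
  have "verts (arc_graph E) = (*) 2 ` (fst ` E) \<union> (\<lambda>b. 2 * b + 1) ` ((fst \<circ> snd) ` E)"
    by (simp add: arc_graph_def image_comp comp_def split_def)
  also have "\<dots> = (*) 2 ` {..m} \<union> (\<lambda>b. 2 * b + 1) ` {..<l}"
    unfolding assms ..
  finally have V: "verts (arc_graph E) = (*) 2 ` {..m} \<union> (\<lambda>b. 2 * b + 1) ` {..<l}" .
  have "2 * a \<noteq> Suc (2 * b)" for a b :: nat by presburger
  then have "(*) 2 ` {..m} \<inter> (\<lambda>b. 2 * b + 1) ` {..<l} = {}" by auto
  moreover have "card ((*) 2 ` {..m}) = Suc m" "card ((\<lambda>b. 2 * b + 1) ` {..<l}) = l"
    by (simp_all add: card_image inj_on_def)
  ultimately show ?thesis unfolding V by (simp add: card_Un_disjoint)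
qed

text \<open>Meant for a gadget with second class \<open>{..<l}\<close>: \<open>l\<close> and
  \<open>Suc l\<close> are two new vertices there, and the negative 4-cycle joins the terminals
  \<open>m\<close> and 0.\<close>

definition digon :: "nat \<Rightarrow> nat \<Rightarrow> arc set" where
  "digon m l = {(0, l, Pos), (m, l, Pos), (0, Suc l, Pos), (m, Suc l, Neg)}"

text \<open>Turns parity claims about colourings of a fixed gadget into propositional ones.\<close>

lemma arc_sign_bits:
  "arc_sign x y = Pos \<longleftrightarrow> ((x mod 4 < 2) = (y mod 4 < 2)) = (odd x \<or> even y)"
  "arc_sign x y = Neg \<longleftrightarrow> \<not> (((x mod 4 < 2) = (y mod 4 < 2)) = (odd x \<or> even y))"
proof -
  have "(x - y) mod 4 < 2 \<longleftrightarrow> ((x mod 4 < 2) = (y mod 4 < 2)) = (odd x \<or> even y)"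
    by presburger
  then show "arc_sign x y = Pos \<longleftrightarrow> ((x mod 4 < 2) = (y mod 4 < 2)) = (odd x \<or> even y)"
    "arc_sign x y = Neg \<longleftrightarrow> \<not> (((x mod 4 < 2) = (y mod 4 < 2)) = (odd x \<or> even y))"
    by (simp_all add: arc_sign_def)
qed

text \<open>The arcs at \<open>l\<close> allow the differences -1, 0, 1 modulo 4, those at
  \<open>Suc l\<close> allow 1, 2, 3; only the odd residues are common to both.\<close>

lemma digon_odd:
  assumes "proper (digon m l) \<phi> \<psi>"
  shows "odd (\<phi> m - \<phi> 0)"
proof -
  have "arc_sign (\<phi> 0) (\<psi> l) = Pos" "arc_sign (\<phi> m) (\<psi> l) = Pos"
    "arc_sign (\<phi> 0) (\<psi> (Suc l)) = Pos" "arc_sign (\<phi> m) (\<psi> (Suc l)) = Neg"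
    using assms by (simp_all add: proper_def digon_def)
  then show ?thesis unfolding arc_sign_bits even_diff_iff even_add by sat
qed

lemma digon_colorable:
  assumes "odd (y - x)"
  obtains w w' where "arc_sign x w = Pos" "arc_sign y w = Pos" "arc_sign x w' = Pos" "arc_sign y w' = Neg"
proof -
  have "(y - x) mod 4 = 1 \<or> (y - x) mod 4 = 3" using assms by presburger
  then consider "(y - x) mod 4 = 1" | "(y - x) mod 4 = 3" by blast
  then show thesis
  proof cases
    case 1
    then have "(y - (x - 1)) mod 4 = 2" by presburger
    with 1 show ?thesis by (intro that[of x "x - 1"]) (simp_all add: arc_sign_def)
  next
    case 2
    then have "(x - y) mod 4 = 1" by presburger
    with 2 show ?thesis by (intro that[of y x]) (simp_all add: arc_sign_def)
  qed
qed

text \<open>\<open>E\<close> does not meet \<open>l\<close> and \<open>Suc l\<close>, so these can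
  be coloured freely. \<open>D\<close> is left open because both a full digon and a digon lacking
  one arc are attached in this way.\<close>

lemma proper_extend:
  assumes "proper E \<phi> \<psi>" and bd: "\<And>a b s. (a, b, s) \<in> E \<Longrightarrow> b < l"
    and D: "\<And>a b s. (a, b, s) \<in> D \<Longrightarrow> arc_sign (\<phi> a) ((\<psi>(l := w, Suc l := w')) b) = s"
  shows "proper (E \<union> D) \<phi> (\<psi>(l := w, Suc l := w'))"
proof -
  have "proper E \<phi> (\<psi>(l := w, Suc l := w'))"
    using assms(1) by (subst proper_cong[of _ _ _ \<phi> \<psi>]) (auto dest: bd)
  moreover have "proper D \<phi> (\<psi>(l := w, Suc l := w'))"
    unfolding proper_def using D by (intro ballI) (simp only: split_paired_all prod.case)
  ultimately show ?thesis by (simp add: proper_Un)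
qed

text \<open>The gadget forces an even terminal difference and the digon an odd one. Deleting a
  gadget arc frees the parity; deleting a digon arc admits one even residue, which flexibility
  provides. \<open>m > 0\<close> keeps the ends of the digon apart.\<close>

lemma critical_close_gadget:
  assumes g: "gadget E m l r" and f: "flexible E m r" and r: "even r" and m: "m > 0"
  shows "C_minus4_critical (arc_graph (E \<union> digon m l))"
    and "card (verts (arc_graph (E \<union> digon m l))) = m + l + 3"
    and "card (edges (arc_graph (E \<union> digon m l))) = card E + 4"
proof -
  let ?C = "E \<union> digon m l"
  have bd: "\<And>a b s. (a, b, s) \<in> E \<Longrightarrow> b < l" using gadget_subset[OF g] by blast
  have finE: "finite E" using gadget_finite[OF g] .
  note injE = gadget_inj_on[OF g] and im = gadget_images[OF g]
  have injC: "inj_on (\<lambda>(a, b, s). (a, b)) ?C"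
    unfolding inj_on_Un
  proof (intro conjI)
    show "inj_on (\<lambda>(a, b, s). (a, b)) (digon m l)" using m by (auto simp: inj_on_def digon_def)
    show "(\<lambda>(a, b, s). (a, b)) ` (E - digon m l) \<inter> (\<lambda>(a, b, s). (a, b)) ` (digon m l - E) = {}"
      by (auto simp: digon_def dest: bd)
  qed (rule injE)
  have "fst ` ?C = {..m}" unfolding image_Un im by (auto simp: digon_def)
  moreover have "(fst \<circ> snd) ` ?C = {..<l + 2}" unfolding image_Un im by (auto simp: digon_def)
  ultimately show "card (verts (arc_graph ?C)) = m + l + 3" by (simp add: card_verts_arc_graph)
  have "card (digon m l) = 4" using m by (simp add: digon_def)
  moreover have "E \<inter> digon m l = {}" by (auto simp: digon_def dest: bd)
  moreover have "finite (digon m l)" by (simp add: digon_def)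
  ultimately have "card ?C = card E + 4" using finE by (simp add: card_Un_disjoint)
  then show "card (edges (arc_graph ?C)) = card E + 4" by (simp add: card_edges_arc_graph[OF injC])
  show "C_minus4_critical (arc_graph ?C)"
  proof (rule critical_arc_graph[OF _ injC])
    show "finite ?C" using finE by (simp add: digon_def)
    show "\<not> proper ?C \<phi> \<psi>" for \<phi> \<psi>
    proof
      assume "proper ?C \<phi> \<psi>"
      then have "proper E \<phi> \<psi>" "proper (digon m l) \<phi> \<psi>" by (simp_all add: proper_Un)
      from gadget_parity[OF g this(1)] digon_odd[OF this(2)] r show False by simp
    qed
    show "\<exists>\<phi> \<psi>. proper (?C - {t}) \<phi> \<psi>" if "t \<in> ?C" for t
      using that
    proof
      assume "t \<in> E"
      then obtain \<phi> \<psi> where c: "proper (E - {t}) \<phi> \<psi>" and "odd (\<phi> m - \<phi> 0 - r)"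
        using gadget_delete[OF g] by metis
      then have "odd (\<phi> m - \<phi> 0)" using r by simp
      then obtain w w' where w: "arc_sign (\<phi> 0) w = Pos" "arc_sign (\<phi> m) w = Pos"
        "arc_sign (\<phi> 0) w' = Pos" "arc_sign (\<phi> m) w' = Neg"
        using digon_colorable by metis
      have "proper ((E - {t}) \<union> digon m l) \<phi> (\<psi>(l := w, Suc l := w'))"
        using c by (rule proper_extend) (use w bd in \<open>auto simp: digon_def\<close>)
      moreover have "?C - {t} \<subseteq> (E - {t}) \<union> digon m l" by blast
      ultimately have "proper (?C - {t}) \<phi> (\<psi>(l := w, Suc l := w'))" by (rule proper_mono)
      then show ?thesis by (intro exI)
    next
      assume t: "t \<in> digon m l"
      have "\<exists>\<phi> \<psi>. proper (E \<union> (digon m l - {t})) \<phi> \<psi>"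
      proof (cases "fst (snd t) = l")
        case True
        then have tt: "t = (0, l, Pos) \<or> t = (m, l, Pos)" using t unfolding digon_def by (cases t) auto
        \<comment> \<open>Both arcs at \<open>Suc l\<close> survive, and 2 is the only even residue
          they allow. The vertex \<open>l\<close> keeps one positive arc and takes the colour of its
          remaining neighbour.\<close>
        obtain \<phi> \<psi> where c: "proper E \<phi> \<psi>" "(\<phi> m - \<phi> 0) mod 4 = 2 mod 4"
          using flexible_coloring[OF f, of 2] r by auto
        let ?w = "if t = (0, l, Pos) then \<phi> m else \<phi> 0"
        have "proper (E \<union> (digon m l - {t})) \<phi> (\<psi>(l := ?w, Suc l := \<phi> 0))"
          using c(1) by (rule proper_extend)
            (use tt c(2) bd m in \<open>auto simp: digon_def arc_sign_def split: if_splits\<close>)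
        then show ?thesis by (intro exI)
      next
        case False
        then have tt: "t = (0, Suc l, Pos) \<or> t = (m, Suc l, Neg)" using t unfolding digon_def by (cases t) auto
        \<comment> \<open>Both arcs at \<open>l\<close> survive, and 0 is the only even residue they
          allow. The single arc left at \<open>Suc l\<close> is negative in the first case, hence
          the offset 2, and positive in the second.\<close>
        obtain \<phi> \<psi> where c: "proper E \<phi> \<psi>" "(\<phi> m - \<phi> 0) mod 4 = 0 mod 4"
          using flexible_coloring[OF f, of 0] r by auto
        let ?w' = "if t = (0, Suc l, Pos) then \<phi> m - 2 else \<phi> 0"
        have "proper (E \<union> (digon m l - {t})) \<phi> (\<psi>(l := \<phi> 0, Suc l := ?w'))"
          using c(1) by (rule proper_extend)
            (use tt c(2) bd m in \<open>auto simp: digon_def arc_sign_def split: if_splits\<close>)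
        then show ?thesis by (intro exI)
      qed
      then obtain \<phi> \<psi> where "proper (E \<union> (digon m l - {t})) \<phi> \<psi>" by (elim exE)
      moreover have "?C - {t} \<subseteq> E \<union> (digon m l - {t})" by blast
      ultimately have "proper (?C - {t}) \<phi> \<psi>" by (rule proper_mono)
      then show ?thesis by (intro exI)
    qed
  qed
qed

section \<open>Explicit gadgets\<close>

text \<open>
  The \<open>i\<close>-th entry of \<open>W\<close> lists the colours of the two classes in a colouring of the wrong parity
  after deletion of the \<open>i\<close>-th arc.
\<close>

lemma gadget_set:
  assumes "set (map fst L) = {..m}" "set (map (fst \<circ> snd) L) = {..<l}"
    and "distinct (map (\<lambda>(a, b, s). (a, b)) L)"
    and "\<And>\<phi> \<psi>. proper (set L) \<phi> \<psi> \<Longrightarrow> even (\<phi> m - \<phi> 0 - r)"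
    and W: "list_all2 (\<lambda>t (xs, ys). proper (set (removeAll t L)) ((!) xs) ((!) ys) \<and>
      odd (xs ! m - xs ! 0 - r)) L W"
    and "proper (set L) ((!) xs) ((!) ys)"
  shows "gadget (set L) m l r"
  unfolding gadget_def
proof (intro conjI allI impI ballI)
  fix t assume "t \<in> set L"
  then obtain i where i: "i < length L" "t = L ! i" by (auto simp: in_set_conv_nth)
  obtain xs ys where "W ! i = (xs, ys)" by fastforce
  with list_all2_nthD[OF W i(1)] i(2)
  have "proper (set L - {t}) ((!) xs) ((!) ys)" "odd (xs ! m - xs ! 0 - r)" by simp_all
  then show "\<exists>\<phi> \<psi>. proper (set L - {t}) \<phi> \<psi> \<and> odd (\<phi> m - \<phi> 0 - r)" by (intro exI conjI)
next
  show "\<exists>\<phi> \<psi>. proper (set L) \<phi> \<psi>" using assms(6) by (intro exI)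
qed (use assms(1-4) in \<open>simp_all add: distinct_map\<close>)

lemma flexibleI:
  assumes "proper E \<phi> \<psi>" "(\<phi> m - \<phi> 0) mod 4 = r mod 4"
    and "proper E \<phi>' \<psi>'" "(\<phi>' m - \<phi>' 0) mod 4 = (r + 2) mod 4"
  shows "flexible E m r"
  unfolding flexible_def
proof (intro allI impI)
  fix d assume "even (d - r)"
  then have "d mod 4 = r mod 4 \<or> d mod 4 = (r + 2) mod 4" by presburger
  then show "\<exists>\<phi> \<psi>. proper E \<phi> \<psi> \<and> (\<phi> m - \<phi> 0) mod 4 = d mod 4"
  proof
    assume "d mod 4 = r mod 4"
    with assms(1,2) show ?thesis by (intro exI[of _ \<phi>] exI[of _ \<psi>]) simp
  next
    assume "d mod 4 = (r + 2) mod 4"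
    with assms(3,4) show ?thesis by (intro exI[of _ \<phi>'] exI[of _ \<psi>']) simp
  qed
qed

lemmas atMost_lessThan_numeral =
  atMost_nat_numeral atMost_0 lessThan_nat_numeral lessThan_Suc lessThan_0

lemmas proper_list_simps = proper_def arc_sign_def nth_Cons_numeral numeral_eq_Suc

text \<open>As a set this is \<open>digon 1 0\<close>. Lists are used because the deletion witnesses
  are matched to the arcs by position. The suffix of the name gives \<open>m\<close> and
  \<open>l\<close>.\<close>

definition arcs_1_2 :: "arc list" where
  "arcs_1_2 =
    [(0, 0, Pos), (1, 0, Pos), (0, 1, Pos), (1, 1, Neg)]"

lemma gadget_1_2: "gadget (set arcs_1_2) 1 2 1"
proof (rule gadget_set)
  show "even (\<phi> 1 - \<phi> 0 - 1)" if "proper (set arcs_1_2) \<phi> \<psi>" for \<phi> \<psi>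
  proof -
    from that have
      "arc_sign (\<phi> 0) (\<psi> 0) = Pos"
      "arc_sign (\<phi> 1) (\<psi> 0) = Pos"
      "arc_sign (\<phi> 0) (\<psi> 1) = Pos"
      "arc_sign (\<phi> 1) (\<psi> 1) = Neg"
      by (simp_all add: proper_def arcs_1_2_def)
    then have "odd (\<phi> 1 - \<phi> 0)" unfolding arc_sign_bits even_diff_iff even_add by sat
    then show ?thesis by simp
  qed
  show "list_all2 (\<lambda>t (xs, ys). proper (set (removeAll t arcs_1_2)) ((!) xs) ((!) ys) \<and>
      odd (xs ! 1 - xs ! 0 - 1)) arcs_1_2
    [([0, 2], [1, 0]), ([0, 2], [0, 0]), ([0, 0], [0, 1]),
     ([0, 0], [0, 0])]"
    by (simp add: arcs_1_2_def proper_list_simps)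
  show "proper (set arcs_1_2) ((!) [0, 1]) ((!) [0, 3])"
    by (simp add: arcs_1_2_def proper_list_simps)
qed (auto simp: arcs_1_2_def atMost_lessThan_numeral)

lemma card_arcs_1_2: "card (set arcs_1_2) = 4"
  by (simp add: arcs_1_2_def)

lemma flexible_1_2: "flexible (set arcs_1_2) 1 1"
  by (rule flexibleI[of _ "(!) [0, 1]" "(!) [0, 3]" _ _
        "(!) [0, 3]" "(!) [3, 0]"])
    (simp_all add: arcs_1_2_def proper_list_simps)

text \<open>Two digons, between 0, 1 and between 1, 2, with both middle vertices in common; two odd
  differences add up to an even one. The middle vertices also differ by an odd number, which forces
  equal colours modulo 4 at the terminals. So the gadget is not flexible and has to follow a
  flexible one.\<close>

definition arcs_2_2 :: "arc list" where
  "arcs_2_2 =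
    [(0, 0, Pos), (0, 1, Pos), (1, 0, Neg), (1, 1, Pos), (2, 0, Pos), (2, 1, Pos)]"

lemma gadget_2_2: "gadget (set arcs_2_2) 2 2 0"
proof (rule gadget_set)
  show "even (\<phi> 2 - \<phi> 0 - 0)" if "proper (set arcs_2_2) \<phi> \<psi>" for \<phi> \<psi>
  proof -
    from that have
      "arc_sign (\<phi> 0) (\<psi> 0) = Pos"
      "arc_sign (\<phi> 0) (\<psi> 1) = Pos"
      "arc_sign (\<phi> 1) (\<psi> 0) = Neg"
      "arc_sign (\<phi> 1) (\<psi> 1) = Pos"
      "arc_sign (\<phi> 2) (\<psi> 0) = Pos"
      "arc_sign (\<phi> 2) (\<psi> 1) = Pos"
      by (simp_all add: proper_def arcs_2_2_def)
    then have "even (\<phi> 2 - \<phi> 0)" unfolding arc_sign_bits even_diff_iff even_add by sat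
    then show ?thesis by simp
  qed
  show "list_all2 (\<lambda>t (xs, ys). proper (set (removeAll t arcs_2_2)) ((!) xs) ((!) ys) \<and>
      odd (xs ! 2 - xs ! 0 - 0)) arcs_2_2
    [([0, 0, 1], [1, 0]), ([0, 2, 1], [0, 1]), ([0, 0, 1], [0, 0]),
     ([0, 1, 3], [3, 3]), ([0, 1, 1], [3, 0]), ([0, 1, 3], [3, 0])]"
    by (simp add: arcs_2_2_def proper_list_simps)
  show "proper (set arcs_2_2) ((!) [0, 3, 0]) ((!) [0, 3])"
    by (simp add: arcs_2_2_def proper_list_simps)
qed (auto simp: arcs_2_2_def atMost_lessThan_numeral)

lemma card_arcs_2_2: "card (set arcs_2_2) = 6"
  by (simp add: arcs_2_2_def)

text \<open>The digons between 0, 1 and between 1, 2 share only the middle vertex 0. Its positive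
  arcs to both terminals reduce their even difference to 0 modulo 4, so this gadget is not flexible
  either.\<close>

definition arcs_2_3 :: "arc list" where
  "arcs_2_3 =
    [(0, 0, Pos), (0, 1, Pos), (1, 0, Neg), (1, 1, Pos), (1, 2, Pos), (2, 0, Pos),
     (2, 2, Pos)]"

lemma gadget_2_3: "gadget (set arcs_2_3) 2 3 0"
proof (rule gadget_set)
  show "even (\<phi> 2 - \<phi> 0 - 0)" if "proper (set arcs_2_3) \<phi> \<psi>" for \<phi> \<psi>
  proof -
    from that have
      "arc_sign (\<phi> 0) (\<psi> 0) = Pos"
      "arc_sign (\<phi> 0) (\<psi> 1) = Pos"
      "arc_sign (\<phi> 1) (\<psi> 0) = Neg"
      "arc_sign (\<phi> 1) (\<psi> 1) = Pos"
      "arc_sign (\<phi> 1) (\<psi> 2) = Pos"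
      "arc_sign (\<phi> 2) (\<psi> 0) = Pos"
      "arc_sign (\<phi> 2) (\<psi> 2) = Pos"
      by (simp_all add: proper_def arcs_2_3_def)
    then have "even (\<phi> 2 - \<phi> 0)" unfolding arc_sign_bits even_diff_iff even_add by sat
    then show ?thesis by simp
  qed
  show "list_all2 (\<lambda>t (xs, ys). proper (set (removeAll t arcs_2_3)) ((!) xs) ((!) ys) \<and>
      odd (xs ! 2 - xs ! 0 - 0)) arcs_2_3
    [([0, 0, 1], [1, 0, 0]), ([0, 2, 1], [0, 1, 1]), ([0, 0, 1], [0, 0, 0]),
     ([0, 2, 1], [0, 0, 1]), ([0, 1, 3], [3, 0, 2]), ([0, 1, 1], [3, 0, 0]),
     ([0, 1, 3], [3, 0, 0])]"
    by (simp add: arcs_2_3_def proper_list_simps)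
  show "proper (set arcs_2_3) ((!) [0, 3, 0]) ((!) [0, 3, 3])"
    by (simp add: arcs_2_3_def proper_list_simps)
qed (auto simp: arcs_2_3_def atMost_lessThan_numeral)

lemma card_arcs_2_3: "card (set arcs_2_3) = 7"
  by (simp add: arcs_2_3_def)

text \<open>The vertices 1, 3, 2 carry a copy of \<open>arcs_2_2\<close> with 3 in the middle, so 1
  and 2 have equal colours modulo 4 and differ from 3 by an odd number. With 1 and 2 identified, the
  remaining four arcs form a digon to 0.\<close>

definition arcs_3_4 :: "arc list" where
  "arcs_3_4 =
    [(0, 0, Neg), (0, 1, Pos), (1, 0, Pos), (1, 2, Pos), (1, 3, Pos), (2, 1, Pos),
     (2, 2, Pos), (2, 3, Pos), (3, 2, Neg), (3, 3, Pos)]"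

lemma gadget_3_4: "gadget (set arcs_3_4) 3 4 0"
proof (rule gadget_set)
  show "even (\<phi> 3 - \<phi> 0 - 0)" if "proper (set arcs_3_4) \<phi> \<psi>" for \<phi> \<psi>
  proof -
    from that have
      "arc_sign (\<phi> 0) (\<psi> 0) = Neg"
      "arc_sign (\<phi> 0) (\<psi> 1) = Pos"
      "arc_sign (\<phi> 1) (\<psi> 0) = Pos"
      "arc_sign (\<phi> 1) (\<psi> 2) = Pos"
      "arc_sign (\<phi> 1) (\<psi> 3) = Pos"
      "arc_sign (\<phi> 2) (\<psi> 1) = Pos"
      "arc_sign (\<phi> 2) (\<psi> 2) = Pos"
      "arc_sign (\<phi> 2) (\<psi> 3) = Pos"
      "arc_sign (\<phi> 3) (\<psi> 2) = Neg"
      "arc_sign (\<phi> 3) (\<psi> 3) = Pos"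
      by (simp_all add: proper_def arcs_3_4_def)
    then have "even (\<phi> 3 - \<phi> 0)" unfolding arc_sign_bits even_diff_iff even_add by sat
    then show ?thesis by simp
  qed
  show "list_all2 (\<lambda>t (xs, ys). proper (set (removeAll t arcs_3_4)) ((!) xs) ((!) ys) \<and>
      odd (xs ! 3 - xs ! 0 - 0)) arcs_3_4
    [([0, 0, 0, 1], [0, 0, 3, 0]), ([0, 2, 2, 1], [1, 1, 2, 1]), ([0, 0, 0, 1], [1, 0, 3, 0]),
     ([0, 1, 0, 1], [1, 0, 3, 0]), ([0, 1, 0, 3], [1, 0, 0, 3]), ([0, 2, 2, 1], [1, 0, 2, 1]),
     ([0, 2, 1, 1], [1, 0, 2, 1]), ([0, 2, 1, 3], [1, 0, 1, 2]), ([0, 1, 0, 1], [1, 0, 0, 0]),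
     ([0, 1, 0, 3], [1, 0, 0, 0])]"
    by (simp add: arcs_3_4_def proper_list_simps)
  show "proper (set arcs_3_4) ((!) [0, 3, 3, 0]) ((!) [2, 3, 2, 3])"
    by (simp add: arcs_3_4_def proper_list_simps)
qed (auto simp: arcs_3_4_def atMost_lessThan_numeral)

lemma card_arcs_3_4: "card (set arcs_3_4) = 10"
  by (simp add: arcs_3_4_def)

lemma flexible_3_4: "flexible (set arcs_3_4) 3 0"
  by (rule flexibleI[of _ "(!) [0, 3, 3, 0]" "(!) [2, 3, 2, 3]" _ _
        "(!) [0, 3, 3, 2]" "(!) [2, 3, 3, 2]"])
    (simp_all add: arcs_3_4_def proper_list_simps)

text \<open>The vertices 0 and 3 form a digon, whose middle vertices 1 and 2 have colours of odd
  difference. The paths from these through the first-class vertices 1 and 2 then force a positive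
  sign between 3 and the second-class vertex 3, as if that arc were present; it would complete a
  digon between 3 and 4.\<close>

definition arcs_4_4 :: "arc list" where
  "arcs_4_4 =
    [(0, 1, Neg), (0, 2, Pos), (1, 2, Pos), (1, 3, Pos), (2, 1, Pos), (2, 3, Pos),
     (3, 0, Neg), (3, 1, Pos), (3, 2, Pos), (4, 0, Pos), (4, 3, Pos)]"

lemma gadget_4_4: "gadget (set arcs_4_4) 4 4 0"
proof (rule gadget_set)
  show "even (\<phi> 4 - \<phi> 0 - 0)" if "proper (set arcs_4_4) \<phi> \<psi>" for \<phi> \<psi>
  proof -
    from that have
      "arc_sign (\<phi> 0) (\<psi> 1) = Neg"
      "arc_sign (\<phi> 0) (\<psi> 2) = Pos"
      "arc_sign (\<phi> 1) (\<psi> 2) = Pos"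
      "arc_sign (\<phi> 1) (\<psi> 3) = Pos"
      "arc_sign (\<phi> 2) (\<psi> 1) = Pos"
      "arc_sign (\<phi> 2) (\<psi> 3) = Pos"
      "arc_sign (\<phi> 3) (\<psi> 0) = Neg"
      "arc_sign (\<phi> 3) (\<psi> 1) = Pos"
      "arc_sign (\<phi> 3) (\<psi> 2) = Pos"
      "arc_sign (\<phi> 4) (\<psi> 0) = Pos"
      "arc_sign (\<phi> 4) (\<psi> 3) = Pos"
      by (simp_all add: proper_def arcs_4_4_def)
    then have "even (\<phi> 4 - \<phi> 0)" unfolding arc_sign_bits even_diff_iff even_add by sat
    then show ?thesis by simp
  qed
  show "list_all2 (\<lambda>t (xs, ys). proper (set (removeAll t arcs_4_4)) ((!) xs) ((!) ys) \<and>
      odd (xs ! 4 - xs ! 0 - 0)) arcs_4_4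
    [([0, 0, 0, 0, 1], [1, 0, 0, 0]), ([0, 1, 1, 2, 1], [0, 1, 1, 0]), ([0, 1, 2, 3, 1], [0, 2, 3, 1]),
     ([0, 0, 2, 1, 3], [2, 1, 0, 2]), ([0, 0, 0, 1, 3], [2, 1, 0, 3]), ([0, 0, 1, 1, 3], [2, 1, 0, 3]),
     ([0, 0, 1, 1, 1], [0, 1, 0, 0]), ([0, 0, 1, 0, 1], [1, 1, 0, 0]), ([0, 0, 1, 2, 1], [0, 1, 0, 0]),
     ([0, 0, 1, 1, 1], [2, 1, 0, 0]), ([0, 0, 1, 1, 3], [2, 1, 0, 0])]"
    by (simp add: arcs_4_4_def proper_list_simps)
  show "proper (set arcs_4_4) ((!) [0, 3, 3, 3, 0]) ((!) [0, 2, 3, 3])"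
    by (simp add: arcs_4_4_def proper_list_simps)
qed (auto simp: arcs_4_4_def atMost_lessThan_numeral)

lemma card_arcs_4_4: "card (set arcs_4_4) = 11"
  by (simp add: arcs_4_4_def)

lemma flexible_4_4: "flexible (set arcs_4_4) 4 0"
  by (rule flexibleI[of _ "(!) [0, 3, 3, 3, 0]" "(!) [0, 2, 3, 3]" _ _
        "(!) [0, 3, 3, 3, 2]" "(!) [1, 2, 3, 2]"])
    (simp_all add: arcs_4_4_def proper_list_simps)

text \<open>Three digons in a row, 0 to 1 to 2 to 3: the first two share both middle vertices and
  the third reuses one of them.\<close>

definition arcs_3_3 :: "arc list" where
  "arcs_3_3 =
    [(0, 0, Neg), (0, 1, Pos), (1, 0, Pos), (1, 1, Pos), (2, 0, Pos), (2, 1, Neg),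
     (2, 2, Pos), (3, 1, Pos), (3, 2, Pos)]"

lemma gadget_3_3: "gadget (set arcs_3_3) 3 3 1"
proof (rule gadget_set)
  show "even (\<phi> 3 - \<phi> 0 - 1)" if "proper (set arcs_3_3) \<phi> \<psi>" for \<phi> \<psi>
  proof -
    from that have
      "arc_sign (\<phi> 0) (\<psi> 0) = Neg"
      "arc_sign (\<phi> 0) (\<psi> 1) = Pos"
      "arc_sign (\<phi> 1) (\<psi> 0) = Pos"
      "arc_sign (\<phi> 1) (\<psi> 1) = Pos"
      "arc_sign (\<phi> 2) (\<psi> 0) = Pos"
      "arc_sign (\<phi> 2) (\<psi> 1) = Neg"
      "arc_sign (\<phi> 2) (\<psi> 2) = Pos"
      "arc_sign (\<phi> 3) (\<psi> 1) = Pos"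
      "arc_sign (\<phi> 3) (\<psi> 2) = Pos"
      by (simp_all add: proper_def arcs_3_3_def)
    then have "odd (\<phi> 3 - \<phi> 0)" unfolding arc_sign_bits even_diff_iff even_add by sat
    then show ?thesis by simp
  qed
  show "list_all2 (\<lambda>t (xs, ys). proper (set (removeAll t arcs_3_3)) ((!) xs) ((!) ys) \<and>
      odd (xs ! 3 - xs ! 0 - 1)) arcs_3_3
    [([0, 0, 1, 0], [0, 3, 0]), ([0, 2, 1, 2], [1, 2, 1]), ([0, 0, 1, 0], [1, 3, 0]),
     ([0, 1, 1, 0], [1, 3, 0]), ([0, 1, 3, 0], [1, 0, 3]), ([0, 1, 1, 0], [1, 0, 0]),
     ([0, 1, 2, 0], [1, 0, 0]), ([0, 1, 2, 2], [1, 0, 1]), ([0, 1, 2, 0], [1, 0, 1])]"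
    by (simp add: arcs_3_3_def proper_list_simps)
  show "proper (set arcs_3_3) ((!) [0, 1, 2, 1]) ((!) [1, 0, 1])"
    by (simp add: arcs_3_3_def proper_list_simps)
qed (auto simp: arcs_3_3_def atMost_lessThan_numeral)

lemma card_arcs_3_3: "card (set arcs_3_3) = 9"
  by (simp add: arcs_3_3_def)

section \<open>Chains of gadgets and the choice by vertex count\<close>

text \<open>Hiding the arc set turns series composition into addition of the four
  parameters.\<close>

definition has_gadget :: "nat \<Rightarrow> nat \<Rightarrow> nat \<Rightarrow> int \<Rightarrow> bool" where
  "has_gadget m l c r \<longleftrightarrow> (\<exists>E. gadget E m l r \<and> card E = c)"

definition has_flexible :: "nat \<Rightarrow> nat \<Rightarrow> nat \<Rightarrow> int \<Rightarrow> bool" where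
  "has_flexible m l c r \<longleftrightarrow> (\<exists>E. gadget E m l r \<and> flexible E m r \<and> card E = c)"

lemma has_flexible_series:
  assumes "has_flexible m1 l1 c1 r1" "has_gadget m2 l2 c2 r2"
  shows "has_flexible (m1 + m2) (l1 + l2) (c1 + c2) (r1 + r2)"
proof -
  obtain E1 E2 where g: "gadget E1 m1 l1 r1" "gadget E2 m2 l2 r2"
    and f: "flexible E1 m1 r1" and c: "card E1 = c1" "card E2 = c2"
    using assms by (auto simp: has_flexible_def has_gadget_def)
  have "card (E1 \<union> shift_arcs m1 l1 E2) = c1 + c2"
    unfolding c[symmetric] using gadget_subset[OF g(1)]
    by (intro card_Un_shift gadget_finite[OF g(1)] gadget_finite[OF g(2)]) auto
  with gadget_series[OF g] flexible_series[OF g(1) f g(2)] show ?thesis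
    unfolding has_flexible_def by (intro exI conjI)
qed

lemma has_flexible_imp_has_gadget: "has_flexible m l c r \<Longrightarrow> has_gadget m l c r"
  by (auto simp: has_flexible_def has_gadget_def)

lemma has_flexible_digon: "has_flexible 1 2 4 1"
  using gadget_1_2 flexible_1_2 card_arcs_1_2 unfolding has_flexible_def by blast

lemma has_flexible_two_digons: "has_flexible 2 4 8 2"
  using has_flexible_series[OF has_flexible_digon has_flexible_imp_has_gadget[OF has_flexible_digon]]
  by (simp add: numeral_eq_Suc)

text \<open>Digons are appended in pairs so that the forced parity does not change.\<close>

lemma has_flexible_chain:
  assumes "has_flexible m l c r"
  shows "has_flexible (m + 2 * j) (l + 4 * j) (c + 8 * j) (r + 2 * int j)"
proof (induction j)
  case (Suc j)
  from has_flexible_series[OF this has_flexible_imp_has_gadget[OF has_flexible_two_digons]]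
  show ?case by (simp add: algebra_simps)
qed (use assms in simp)

lemma critical_of_flexible:
  assumes "has_flexible m l c r" "even r" "m > 0"
  shows "\<exists>G :: nat signed_graph. C_minus4_critical G \<and>
    card (verts G) = m + l + 3 + 6 * j \<and> card (edges G) = c + 4 + 8 * j"
proof -
  obtain E where E: "gadget E (m + 2 * j) (l + 4 * j) (r + 2 * int j)"
      "flexible E (m + 2 * j) (r + 2 * int j)" "card E = c + 8 * j"
    using has_flexible_chain[OF assms(1), of j] by (auto simp: has_flexible_def)
  have "even (r + 2 * int j)" "m + 2 * j > 0" using assms(2,3) by auto
  note C = critical_close_gadget[OF E(1,2) this]
  show ?thesis
    by (intro exI[of _ "arc_graph (E \<union> digon (m + 2 * j) (l + 4 * j))"]) (simp add: C E(3))
qed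

theorem mainTheorem2:
  fixes n :: nat
  assumes "n \<ge> 9"
  shows "\<exists>G :: nat signed_graph. C_minus4_critical G \<and> card (verts G) = n \<and>
           (int (card (edges G)) = \<lceil>4 * real n / 3\<rceil> \<or>
            int (card (edges G)) = \<lceil>4 * real n / 3\<rceil> + 1)"
proof -
  define j where "j = (n - 9) div 6"
  have n: "n \<in> {9 + 6 * j, 10 + 6 * j, 11 + 6 * j, 12 + 6 * j, 13 + 6 * j, 14 + 6 * j}"
    unfolding j_def using assms by simp presburger
  have ceil: "\<lceil>4 * real n / 3\<rceil> = k" if "4 * int n \<le> 3 * k" "3 * k < 4 * int n + 3" for k
    using that by (intro ceiling_unique) linarith+
  note DD = has_flexible_two_digons
  have "has_gadget 3 3 9 1" "has_gadget 2 2 6 0" "has_gadget 2 3 7 0"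
    using gadget_3_3 card_arcs_3_3 gadget_2_2 card_arcs_2_2 gadget_2_3 card_arcs_2_3
    unfolding has_gadget_def by blast+
  \<comment> \<open>The gadgets not shown to be flexible come second. The sums of the parities are
    all 2, as closing requires an even value.\<close>
  note series = has_flexible_series[OF has_flexible_digon this(1)]
    has_flexible_series[OF DD this(2)] has_flexible_series[OF DD this(3)]
  have F: "has_flexible 3 4 10 0" "has_flexible 4 4 11 0"
    using gadget_3_4 flexible_3_4 card_arcs_3_4 gadget_4_4 flexible_4_4 card_arcs_4_4
    unfolding has_flexible_def by blast+
  from n consider "n = 9 + 6 * j" | "n = 10 + 6 * j" | "n = 11 + 6 * j" | "n = 12 + 6 * j"
    | "n = 13 + 6 * j" | "n = 14 + 6 * j"
    by blast
  then show ?thesis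
  proof cases
    case 1
    then show ?thesis using critical_of_flexible[OF DD, of j] ceil[of "12 + 8 * int j"] by force
  next
    case 2
    then show ?thesis using critical_of_flexible[OF F(1), of j] ceil[of "14 + 8 * int j"] by force
  next
    case 3
    then show ?thesis using critical_of_flexible[OF F(2), of j] ceil[of "15 + 8 * int j"] by force
  next
    case 4
    \<comment> \<open>The only case with one edge above the ceiling: \<open>17 + 8 * j\<close> edges
      on \<open>12 + 6 * j\<close> vertices. A closed chain of digons of this size would have evenly
      many links and be colourable.\<close>
    then show ?thesis using critical_of_flexible[OF series(1), of j] ceil[of "16 + 8 * int j"] by force
  next
    case 5
    then show ?thesis using critical_of_flexible[OF series(2), of j] ceil[of "18 + 8 * int j"] by force
  next
    case 6
    then show ?thesis using critical_of_flexible[OF series(3), of j] ceil[of "19 + 8 * int j"] by force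
  qed
qed

end
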